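(* Let $V=(V_t)_{t\in[0,\tau]}$ be a VMO process. Then $$\mathbb E_r\, e^{\lambda\sup_{t\in[r,\tau]}|V_t-V_r|}<\infty\ \text{ (a.s.)}\quad\text{for every }r\in[0,\tau]\text{ and every }\lambda>0.$$ If moreover $V$ belongs to $\mathrm{VMO}^{p\text{-}\mathrm{var}}$ for some $p\in[1,\infty)$, then $$\sup_{r\in[0,\tau]}\mathbb E_r\, e^{\lambda\sup_{t\in[r,\tau]}|V_t-V_r|}\le 2^{1+(22\lambda)^p w_{0,\tau}(V)}\quad\text{for every }\lambda>0,$$ where $w_{0,\tau}(V)=([V]_{\mathrm{VMO}^{p\text{-}\mathrm{var}};[0,\tau]})^p$; the inequality is understood as: for every $r\in[0,\tau]$, the conditional expectation is almost surely bounded by the right-hand side.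
   Context: Fix $\tau>0$ and a probability space $(\Omega,\mathcal G,\mathbb P)$ with a filtration $\{\mathcal F_t\}_{t\ge0}$ satisfying the usual conditions. For a stopping time $S$, $\mathbb E_S$ denotes conditional expectation given $\mathcal F_S$; $\|\cdot\|_m$ is the norm of $L^m(\Omega,\mathcal G,\mathbb P)$, $m\in[1,\infty]$. For an RCLL process, $V_{s-}=\lim_{r\uparrow s}V_r$ and $V_{0-}:=V_0$. A real-valued adapted RCLL process $(V_t)_{t\in[0,\tau]}$ is BMO if $[V]_{\mathrm{BMO}}:=\sup_{0\le S\le T\le\tau}\|\mathbb E_S|V_T-V_{S-}|\|_\infty<\infty$, the supremum being over all stopping times $S,T$ with $0\le S\le T\le\tau$. For a BMO process $V$ and $0\le s\le t\le\tau$, $\rho_{s,t}(V)=\sup_{s\le S\le T\le t}\|\mathbb E_S|V_T-V_{S-}|\|_\infty$ (supremum over stopping times $S,T$ with $s\le S\le T\le t$), and $\kappa_{s,t}(V)=\lim_{h\downarrow0}\sup_{s\le u\le v\le t,\ v-u\le h}\rho_{u,v}(V)$. A BMO process $V$ is VMO if $\kappa_{0,\tau}(V)=0$. For $p\in[1,\infty)$, a VMO process $V$ is $\mathrm{VMO}^{p\text{-}\mathrm{var}}$ if $[V]_{\mathrm{VMO}^{p\text{-}\mathrm{var}};[0,\tau]}:=\big(\sup_{\pi}\sum_{[s,t]\in\pi}|\rho_{s,t}(V)|^p\big)^{1/p}<\infty$, the supremum being over all finite partitions $\pi$ of $[0,\tau]$. *)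

theory Defs
  imports "HOL-Probability.Probability"
begin

text \<open>Time is indexed by \<^typ>\<open>real\<close>. Only \<open>F t\<close> with \<open>t \<ge> 0\<close> carries information: a filtration on
  \<open>[0,\<infinity>)\<close> is extended to negative times by \<open>F t = F 0\<close>, and for a nonnegative random time \<open>S\<close> the
  conditions at \<open>t < 0\<close> in \<^const>\<open>stopping_time\<close> and \<^const>\<open>filtration.pre_sigma\<close> concern only
  the empty set.\<close>

locale usual_filtered_prob_space =
  prob_space M + complete_measure M + filtration "space M" F
  for M :: "'a measure" and F :: "real \<Rightarrow> 'a measure" +
  assumes subalgebra_F: "\<And>t. subalgebra M (F t)"
    and null_sets_F: "null_sets M \<subseteq> sets (F 0)"
    and right_continuous_F: "\<And>t. 0 \<le> t \<Longrightarrow> sets (F t) = (\<Inter>s\<in>{t<..}. sets (F s))"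

definition adapted_rcll ::
    "'a measure \<Rightarrow> (real \<Rightarrow> 'a measure) \<Rightarrow> real \<Rightarrow> (real \<Rightarrow> 'a \<Rightarrow> real) \<Rightarrow> bool" where
  "adapted_rcll M F \<tau> V \<longleftrightarrow>
     (\<forall>t\<in>{0..\<tau>}. V t \<in> borel_measurable (F t)) \<and>
     (\<forall>\<omega>\<in>space M.
        (\<forall>t\<in>{0..<\<tau>}. ((\<lambda>s. V s \<omega>) \<longlongrightarrow> V t \<omega>) (at_right t)) \<and>
        (\<forall>t\<in>{0<..\<tau>}. \<exists>l. ((\<lambda>s. V s \<omega>) \<longlongrightarrow> l) (at_left t)))"

definition left_limit :: "(real \<Rightarrow> 'a \<Rightarrow> real) \<Rightarrow> real \<Rightarrow> 'a \<Rightarrow> real" where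
  "left_limit V s \<omega> = (if s = 0 then V 0 \<omega> else Lim (at_left s) (\<lambda>r. V r \<omega>))"

definition stopping_pairs ::
    "'a measure \<Rightarrow> (real \<Rightarrow> 'a measure) \<Rightarrow> real \<Rightarrow> real \<Rightarrow> (('a \<Rightarrow> real) \<times> ('a \<Rightarrow> real)) set" where
  "stopping_pairs M F s t =
     {(S, T). stopping_time F S \<and> stopping_time F T \<and>
              (\<forall>\<omega>\<in>space M. s \<le> S \<omega> \<and> S \<omega> \<le> T \<omega> \<and> T \<omega> \<le> t)}"

definition rho ::
    "'a measure \<Rightarrow> (real \<Rightarrow> 'a measure) \<Rightarrow> (real \<Rightarrow> 'a \<Rightarrow> real) \<Rightarrow> real \<Rightarrow> real \<Rightarrow> ennreal" where
  "rho M F V s t =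
     (SUP (S, T)\<in>stopping_pairs M F s t.
        esssup M (nn_cond_exp M (filtration.pre_sigma (space M) F S)
          (\<lambda>\<omega>. ennreal \<bar>V (T \<omega>) \<omega> - left_limit V (S \<omega>) \<omega>\<bar>)))"

definition bmo_seminorm ::
    "'a measure \<Rightarrow> (real \<Rightarrow> 'a measure) \<Rightarrow> real \<Rightarrow> (real \<Rightarrow> 'a \<Rightarrow> real) \<Rightarrow> ennreal" where
  "bmo_seminorm M F \<tau> V = rho M F V 0 \<tau>"

definition BMO ::
    "'a measure \<Rightarrow> (real \<Rightarrow> 'a measure) \<Rightarrow> real \<Rightarrow> (real \<Rightarrow> 'a \<Rightarrow> real) \<Rightarrow> bool" where
  "BMO M F \<tau> V \<longleftrightarrow> adapted_rcll M F \<tau> V \<and> bmo_seminorm M F \<tau> V < \<infinity>"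

definition kappa ::
    "'a measure \<Rightarrow> (real \<Rightarrow> 'a measure) \<Rightarrow> (real \<Rightarrow> 'a \<Rightarrow> real) \<Rightarrow> real \<Rightarrow> real \<Rightarrow> ennreal" where
  "kappa M F V s t =
     Lim (at_right 0)
       (\<lambda>h. SUP (u, v)\<in>{(u, v). s \<le> u \<and> u \<le> v \<and> v \<le> t \<and> v - u \<le> h}. rho M F V u v)"

text \<open>The limit in \<^const>\<open>kappa\<close> always exists, the supremum being monotone in \<open>h\<close>.\<close>

lemma kappa_eq_INF:
  "kappa M F V s t =
     (INF h\<in>{0<..}. SUP (u, v)\<in>{(u, v). s \<le> u \<and> u \<le> v \<and> v \<le> t \<and> v - u \<le> h}. rho M F V u v)"
  (is "_ = (INF h\<in>_. ?f h)")
proof -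
  have mono: "?f h \<le> ?f h'" if "h \<le> h'" for h h'
    using that by (intro SUP_subset_mono) auto
  have "(?f \<longlongrightarrow> (INF h\<in>{0<..}. ?f h)) (at_right 0)"
  proof (rule order_tendstoI)
    fix a assume a: "a < (INF h\<in>{0<..}. ?f h)"
    have "eventually (\<lambda>h::real. h \<in> {0<..}) (at_right 0)"
      by (simp add: eventually_at_right_less)
    then show "eventually (\<lambda>h. a < ?f h) (at_right 0)"
      by eventually_elim (rule less_le_trans[OF a INF_lower])
  next
    fix a assume "(INF h\<in>{0<..}. ?f h) < a"
    then obtain h where h: "0 < h" "?f h < a"
      by (auto simp: INF_less_iff)
    have "eventually (\<lambda>x. x < h) (at_right 0)"
      using h(1) by (auto simp: eventually_at_right)
    then show "eventually (\<lambda>x. ?f x < a) (at_right 0)"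
      by eventually_elim (rule le_less_trans[OF mono h(2)], simp)
  qed
  then show ?thesis
    unfolding kappa_def by (intro tendsto_Lim) simp_all
qed

definition VMO ::
    "'a measure \<Rightarrow> (real \<Rightarrow> 'a measure) \<Rightarrow> real \<Rightarrow> (real \<Rightarrow> 'a \<Rightarrow> real) \<Rightarrow> bool" where
  "VMO M F \<tau> V \<longleftrightarrow> BMO M F \<tau> V \<and> kappa M F V 0 \<tau> = 0"

text \<open>Powers with positive real exponent on \<open>[0,\<infinity>]\<close>.\<close>

definition enn_powr :: "ennreal \<Rightarrow> real \<Rightarrow> ennreal" where
  "enn_powr x a = (if x = \<infinity> then \<infinity> else ennreal (enn2real x powr a))"

text \<open>Partitions \<open>0 = \<pi> 0 < \<dots> < \<pi> n = \<tau>\<close> are given by their points. The library's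
  \<^const>\<open>division_of\<close> is not suitable here: it admits degenerate intervals, on which
  \<^const>\<open>rho\<close> need not vanish because it sees the jumps of the process.\<close>

definition partitions :: "real \<Rightarrow> (nat \<times> (nat \<Rightarrow> real)) set" where
  "partitions \<tau> = {(n, \<pi>). \<pi> 0 = 0 \<and> \<pi> n = \<tau> \<and> (\<forall>i<n. \<pi> i < \<pi> (Suc i))}"

definition vmo_pvar_seminorm ::
    "'a measure \<Rightarrow> (real \<Rightarrow> 'a measure) \<Rightarrow> real \<Rightarrow> real \<Rightarrow> (real \<Rightarrow> 'a \<Rightarrow> real) \<Rightarrow> ennreal" where
  "vmo_pvar_seminorm M F p \<tau> V =
     enn_powr (SUP (n, \<pi>)\<in>partitions \<tau>. \<Sum>i<n. enn_powr (rho M F V (\<pi> i) (\<pi> (Suc i))) p) (1 / p)"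

definition VMO_pvar ::
    "'a measure \<Rightarrow> (real \<Rightarrow> 'a measure) \<Rightarrow> real \<Rightarrow> real \<Rightarrow> (real \<Rightarrow> 'a \<Rightarrow> real) \<Rightarrow> bool" where
  "VMO_pvar M F p \<tau> V \<longleftrightarrow> VMO M F \<tau> V \<and> vmo_pvar_seminorm M F p \<tau> V < \<infinity>"

text \<open>Real-valued control, meaningful for processes satisfying \<^const>\<open>VMO_pvar\<close>.\<close>

definition vmo_control ::
    "'a measure \<Rightarrow> (real \<Rightarrow> 'a measure) \<Rightarrow> real \<Rightarrow> real \<Rightarrow> (real \<Rightarrow> 'a \<Rightarrow> real) \<Rightarrow> real" where
  "vmo_control M F p \<tau> V = enn2real (vmo_pvar_seminorm M F p \<tau> V) powr p"

text \<open>The supremum is a real one: the paths are bounded on \<open>[0,\<tau>]\<close>, being RCLL.\<close>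

definition cond_exp_moment ::
    "'a measure \<Rightarrow> (real \<Rightarrow> 'a measure) \<Rightarrow> real \<Rightarrow> (real \<Rightarrow> 'a \<Rightarrow> real) \<Rightarrow> real \<Rightarrow> real \<Rightarrow> 'a \<Rightarrow> ennreal"
  where
  "cond_exp_moment M F \<tau> V c r =
     nn_cond_exp M (F r) (\<lambda>\<omega>. ennreal (exp (c * (SUP t\<in>{r..\<tau>}. \<bar>V t \<omega> - V r \<omega>\<bar>))))"

end

theory Submission
  imports Defs
begin

text \<open>Let \<open>Z = sup |V u - V s|\<close> over \<open>[s,t]\<close>, suppose \<open>\<rho>\<^sub>s\<^sub>,\<^sub>t \<le> c\<close>, and let \<open>T\<^sub>b\<close> be the first time that
  \<open>|V u - V s|\<close> exceeds \<open>b > 0\<close>. On \<open>{Z > b + 2c}\<close> the path moves by at least \<open>2c\<close> between \<open>T\<^sub>b-\<close> and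
  \<open>T\<^sub>b\<^sub>+\<^sub>2\<^sub>c\<close>, so \<open>P(Z > b + 2c) \<le> P(Z > b) / 2\<close> conditionally on \<open>F s\<close>. Hence the tail of \<open>Z\<close> is
  geometric (John-Nirenberg), and the conditional expectation of \<open>exp (\<beta> Z)\<close> is at most \<open>7/5\<close> when
  \<open>22 \<beta> c = 1\<close>.

  Starting at \<open>r\<close>, cut \<open>[r,\<tau>]\<close> greedily into blocks with \<open>\<rho> > c\<close> and a last interval with \<open>\<rho> \<le> c\<close>.
  As \<open>\<rho>\<close> is small on short intervals, a block splits into two intervals with \<open>\<rho> \<le> c\<close>; it
  therefore contributes a factor of at most \<open>(7/5)\<^sup>2 \<le> 2\<close> by the tower property. The number \<open>N\<close> of
  blocks is finite because each is longer than some \<open>h > 0\<close>, and \<open>N c\<^sup>p \<le> w\<^sub>0\<^sub>,\<^sub>\<tau>\<close>.\<close>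

subsection \<open>Preliminaries\<close>

text \<open>On the \<open>F\<close>-set where the conditional expectation exceeds
  \<open>c + e\<close>, integration would give
  \<open>(c + e) * emeasure M A \<le> c * emeasure M A\<close>, so this set is null for every
  \<open>e > 0\<close>. This brings integrated bounds back to almost sure ones.\<close>

lemma (in sigma_finite_subalgebra) AE_nn_cond_exp_le:
  fixes c :: ennreal
  assumes [measurable]: "f \<in> borel_measurable M"
    and fin: "emeasure M (space M) < \<infinity>"
    and le: "\<And>A. A \<in> sets F \<Longrightarrow> (\<integral>\<^sup>+\<omega>\<in>A. f \<omega> \<partial>M) \<le> c * emeasure M A"
  shows "AE \<omega> in M. nn_cond_exp M F f \<omega> \<le> c"
proof (rule AE_upper_bound_inf_ennreal)
  fix e :: real assume e: "0 < e"
  let ?g = "nn_cond_exp M F f"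
  define A where "A = {\<omega>\<in>space F. c + ennreal e < ?g \<omega>}"
  have AF[measurable]: "A \<in> sets F"
    unfolding A_def by measurable
  have sp: "space F = space M" and AM: "A \<in> sets M"
    using subalg AF by (auto simp: subalgebra_def)
  have "emeasure M A = 0"
  proof (cases "c = \<infinity>")
    case True
    then show ?thesis by (simp add: A_def)
  next
    case False
    have finA: "emeasure M A < \<infinity>"
      using emeasure_mono[OF _ sets.top, of A M] fin sets.sets_into_space[OF AM]
      by (meson emeasure_space le_less_trans)
    have "(c + ennreal e) * emeasure M A = (\<integral>\<^sup>+\<omega>\<in>A. (c + ennreal e) \<partial>M)"
      using AM by (simp add: nn_integral_cmult_indicator)
    also have "\<dots> \<le> (\<integral>\<^sup>+\<omega>\<in>A. ?g \<omega> \<partial>M)"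
      by (intro nn_integral_mono) (auto simp: A_def indicator_def)
    also have "\<dots> = (\<integral>\<^sup>+\<omega>\<in>A. f \<omega> \<partial>M)"
      using nn_cond_exp_intg[of "indicator A" f] by (simp add: mult.commute)
    also have "\<dots> \<le> c * emeasure M A"
      by (rule le) fact
    finally have "c * emeasure M A + ennreal e * emeasure M A \<le> c * emeasure M A + 0"
      by (simp add: distrib_right)
    \<comment> \<open>Finiteness of the common summand is what permits cancelling it in
      \<open>ennreal\<close>.\<close>
    moreover have "c * emeasure M A < \<infinity>"
      using False finA by (simp add: ennreal_mult_less_top less_top)
    ultimately have "ennreal e * emeasure M A \<le> 0"
      by (auto simp: ennreal_add_left_cancel_le)
    then show ?thesis using e by (simp add: ennreal_eq_0_iff)
  qed
  then show "AE \<omega> in M. ?g \<omega> \<le> c + ennreal e"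
    using AM by (intro AE_I[of _ _ A]) (auto simp: A_def sp not_le)
qed

text \<open>Under an \<open>F\<close>-measurable weight, \<open>f\<close> may be replaced by its
  conditional expectation. The weight will be an indicator for increments, and the exponential over
  an earlier interval for the tower property.\<close>

lemma (in sigma_finite_subalgebra) nn_integral_mult_le_of_nn_cond_exp_le:
  fixes c :: ennreal
  assumes [measurable]: "f \<in> borel_measurable M" "g \<in> borel_measurable F"
    and le: "AE \<omega> in M. nn_cond_exp M F f \<omega> \<le> c"
  shows "(\<integral>\<^sup>+\<omega>. g \<omega> * f \<omega> \<partial>M) \<le> c * (\<integral>\<^sup>+\<omega>. g \<omega> \<partial>M)"
proof -
  have [measurable]: "g \<in> borel_measurable M"
    using subalg by (rule measurable_from_subalg) fact
  have "(\<integral>\<^sup>+\<omega>. g \<omega> * f \<omega> \<partial>M) = (\<integral>\<^sup>+\<omega>. g \<omega> * nn_cond_exp M F f \<omega> \<partial>M)"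
    by (rule nn_cond_exp_intg[symmetric]) auto
  also have "\<dots> \<le> (\<integral>\<^sup>+\<omega>. c * g \<omega> \<partial>M)"
  proof (rule nn_integral_mono_AE)
    show "AE \<omega> in M. g \<omega> * nn_cond_exp M F f \<omega> \<le> c * g \<omega>"
      using le by eventually_elim (metis mult.commute mult_left_mono zero_le)
  qed
  also have "\<dots> = c * (\<integral>\<^sup>+\<omega>. g \<omega> \<partial>M)"
    by (simp add: nn_integral_cmult)
  finally show ?thesis .
qed

text \<open>Serves to cut a block into two pieces: \<open>P u\<close> will say that
  \<open>rho\<close> from the start of the block up to \<open>u\<close> is small.\<close>

lemma exists_short_crossing:
  fixes a b h :: real
  assumes "a \<le> b" "0 < h" "P a" "\<not> P b"
  shows "\<exists>u v. a \<le> u \<and> u < v \<and> v \<le> b \<and> v - u \<le> h \<and> P u \<and> \<not> P v"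
proof -
  define X where "X = {u\<in>{a..b}. P u}"
  have X: "X \<noteq> {}" "bdd_above X"
    using assms by (auto simp: X_def intro!: bdd_aboveI[of _ b])
  \<comment> \<open>The supremum need not belong to \<open>X\<close>. A point of \<open>X\<close>
    within \<open>h\<close> below it suffices, since \<open>u + h\<close> then lies beyond
    \<open>Sup X\<close>, where \<open>P\<close> fails as long as \<open>b\<close> is not
    passed.\<close>
  obtain u where u: "u \<in> X" "Sup X - h < u"
    using less_cSup_iff[OF X, of "Sup X - h"] assms(2) by auto
  have ub: "u < b"
    using u(1) assms(4) by (cases "u = b") (auto simp: X_def)
  have "\<not> P (min b (u + h))"
  proof
    assume P: "P (min b (u + h))"
    with assms(4) have "\<not> b \<le> u + h" by (auto simp: min_def)
    with P u(1) assms(2) have "u + h \<in> X" by (auto simp: X_def min_def)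
    then have "u + h \<le> Sup X" using X(2) by (rule cSup_upper)
    with u(2) show False by simp
  qed
  then show ?thesis
    using u(1) ub assms(2) by (intro exI[of _ u] exI[of _ "min b (u + h)"]) (auto simp: X_def)
qed

subsection \<open>Paths and measurability\<close>

text \<open>Smallness of \<open>rho\<close> enters as a hypothesis of single lemmas; VMO itself is
  used only in the final theorem.\<close>

locale rcll_process = usual_filtered_prob_space M F
  for M :: "'a measure" and F :: "real \<Rightarrow> 'a measure" +
  fixes \<tau> :: real and V :: "real \<Rightarrow> 'a \<Rightarrow> real"
  assumes tau_pos: "0 < \<tau>"
    and rcll: "adapted_rcll M F \<tau> V"
begin

lemma sets_F_subset: "sets (F t) \<subseteq> sets M"
  using subalgebra_F[of t] by (simp add: subalgebra_def)

lemma measurable_F_mono: "f \<in> borel_measurable (F s) \<Longrightarrow> s \<le> t \<Longrightarrow> f \<in> borel_measurable (F t)"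
  using sets_F_mono[of s t] unfolding measurable_def by (auto simp: space_F)

lemma adapted: "0 \<le> t \<Longrightarrow> t \<le> \<tau> \<Longrightarrow> V t \<in> borel_measurable (F t)"
  using rcll by (auto simp: adapted_rcll_def)

lemma adapted_later:
  "0 \<le> s \<Longrightarrow> s \<le> \<tau> \<Longrightarrow> s \<le> t \<Longrightarrow> V s \<in> borel_measurable (F t)"
  using adapted measurable_F_mono by blast

lemma measurable_V: "0 \<le> t \<Longrightarrow> t \<le> \<tau> \<Longrightarrow> V t \<in> borel_measurable M"
  using adapted measurable_from_subalg[OF subalgebra_F] by blast

lemma path_right:
  "\<omega> \<in> space M \<Longrightarrow> 0 \<le> t \<Longrightarrow> t < \<tau> \<Longrightarrow> ((\<lambda>s. V s \<omega>) \<longlongrightarrow> V t \<omega>) (at_right t)"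
  using rcll by (auto simp: adapted_rcll_def)

lemma path_left:
  assumes "\<omega> \<in> space M" "0 < t" "t \<le> \<tau>"
  shows "((\<lambda>s. V s \<omega>) \<longlongrightarrow> left_limit V t \<omega>) (at_left t)"
proof -
  obtain l where "((\<lambda>s. V s \<omega>) \<longlongrightarrow> l) (at_left t)"
    using rcll assms by (fastforce simp: adapted_rcll_def)
  then show ?thesis
    using assms tendsto_Lim[of "at_left t" "\<lambda>s. V s \<omega>" l] by (simp add: left_limit_def)
qed

text \<open>One-sided limits bound the path near each point, and bounds on adjacent intervals
  combine; bisection makes this global.\<close>

lemma path_bounded:
  assumes w: "\<omega> \<in> space M"
  shows "\<exists>B. \<forall>u\<in>{0..\<tau>}. \<bar>V u \<omega>\<bar> \<le> B"
proof -
  \<comment> \<open>The intersection with \<open>{0..\<tau>}\<close> is there because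
    \<open>Bolzano\<close> also tests intervals around the endpoints that stick out.\<close>
  define P where "P a b \<longleftrightarrow> (\<exists>B. \<forall>u\<in>{a..b} \<inter> {0..\<tau>}. \<bar>V u \<omega>\<bar> \<le> B)" for a b
  have "0 \<le> \<tau>" using tau_pos by simp
  then have "P 0 \<tau>"
  proof (rule Bolzano[where P = P])
    fix a b c :: real assume "P a b" "P b c"
    then obtain B B' where "\<forall>u\<in>{a..b} \<inter> {0..\<tau>}. \<bar>V u \<omega>\<bar> \<le> B" "\<forall>u\<in>{b..c} \<inter> {0..\<tau>}. \<bar>V u \<omega>\<bar> \<le> B'"
      unfolding P_def by blast
    then have "\<forall>u\<in>{a..c} \<inter> {0..\<tau>}. \<bar>V u \<omega>\<bar> \<le> max B B'"
      by (metis Int_iff atLeastAtMost_iff linear max.coboundedI1 max.coboundedI2)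
    then show "P a c" unfolding P_def by blast
  next
    fix x assume local: "0 \<le> x" "x \<le> \<tau>"
    have right: "\<exists>d>0. \<exists>B. \<forall>u. x < u \<and> u < x + d \<and> u \<le> \<tau> \<longrightarrow> \<bar>V u \<omega>\<bar> \<le> B"
    proof (cases "x < \<tau>")
      case True
      have "((\<lambda>s. \<bar>V s \<omega>\<bar>) \<longlongrightarrow> \<bar>V x \<omega>\<bar>) (at_right x)"
        using path_right[OF w _ True] local by (intro tendsto_rabs) auto
      from order_tendstoD(2)[OF this, of "\<bar>V x \<omega>\<bar> + 1"]
      obtain y where "x < y" "\<forall>u. x < u \<and> u < y \<longrightarrow> \<bar>V u \<omega>\<bar> < \<bar>V x \<omega>\<bar> + 1"
        by (auto simp: eventually_at_right[OF True])
      then show ?thesis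
        by (intro exI[of _ "y - x"]) (auto intro!: exI[of _ "\<bar>V x \<omega>\<bar> + 1"] less_imp_le)
    next
      case False
      then show ?thesis by (intro exI[of _ 1]) auto
    qed
    have left: "\<exists>d>0. \<exists>B. \<forall>u. x - d < u \<and> u < x \<and> 0 \<le> u \<longrightarrow> \<bar>V u \<omega>\<bar> \<le> B"
    proof (cases "0 < x")
      case True
      have "((\<lambda>s. \<bar>V s \<omega>\<bar>) \<longlongrightarrow> \<bar>left_limit V x \<omega>\<bar>) (at_left x)"
        using path_left[OF w True] local by (intro tendsto_rabs) auto
      from order_tendstoD(2)[OF this, of "\<bar>left_limit V x \<omega>\<bar> + 1"]
      obtain y where "y < x" "\<forall>u. y < u \<and> u < x \<longrightarrow> \<bar>V u \<omega>\<bar> < \<bar>left_limit V x \<omega>\<bar> + 1"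
        by (auto simp: eventually_at_left[OF True])
      then show ?thesis
        by (intro exI[of _ "x - y"])
           (auto intro!: exI[of _ "\<bar>left_limit V x \<omega>\<bar> + 1"] less_imp_le)
    next
      case False
      then show ?thesis by (intro exI[of _ 1]) auto
    qed
    from right left obtain d B d' B' where d: "0 < d" "0 < d'"
      and B: "\<And>u. x < u \<Longrightarrow> u < x + d \<Longrightarrow> u \<le> \<tau> \<Longrightarrow> \<bar>V u \<omega>\<bar> \<le> B"
      and B': "\<And>u. x - d' < u \<Longrightarrow> u < x \<Longrightarrow> 0 \<le> u \<Longrightarrow> \<bar>V u \<omega>\<bar> \<le> B'"
      by metis
    have "P a b" if "a \<le> x" "x \<le> b" "b - a < min d d'" for a b
      unfolding P_def
    proof (intro exI ballI)
      fix u assume u: "u \<in> {a..b} \<inter> {0..\<tau>}"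
      consider "u < x" | "u = x" | "x < u" by linarith
      then show "\<bar>V u \<omega>\<bar> \<le> max \<bar>V x \<omega>\<bar> (max B B')"
        using u that B[of u] B'[of u] by cases auto
    qed
    then show "\<exists>d>0. \<forall>a b. a \<le> x \<and> x \<le> b \<and> b - a < d \<longrightarrow> P a b"
      using d by (intro exI[of _ "min d d'"]) auto
  qed
  then show ?thesis by (simp add: P_def)
qed

section \<open>Measurability of values and left limits at random times\<close>

text \<open>Right continuity makes the value at \<open>U\<close> a limit of values at countably
  valued times that approach \<open>U\<close> from above.\<close>

lemma measurable_stopped:
  assumes U[measurable]: "U \<in> borel_measurable M"
    and range: "\<And>\<omega>. \<omega> \<in> space M \<Longrightarrow> 0 \<le> U \<omega> \<and> U \<omega> \<le> \<tau>"
  shows "(\<lambda>\<omega>. V (U \<omega>) \<omega>) \<in> borel_measurable M"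
proof (rule borel_measurable_LIMSEQ_real)
  \<comment> \<open>The \<open>+ 1\<close> puts the grid point strictly above \<open>U\<close>.
    Clipping makes every integer index, negative ones included, an admissible time.\<close>
  let ?D = "\<lambda>n i. max 0 (min \<tau> ((of_int i + 1) / real (Suc n)))"
  let ?i = "\<lambda>n \<omega>. \<lfloor>real (Suc n) * U \<omega>\<rfloor>"
  show "(\<lambda>\<omega>. V (?D n (?i n \<omega>)) \<omega>) \<in> borel_measurable M" for n
  proof (rule measurable_compose_countable[where f = "\<lambda>i. V (?D n i)" and g = "?i n"])
    show "V (?D n i) \<in> borel_measurable M" for i
      using tau_pos by (intro measurable_V) auto
  qed measurable
  show "(\<lambda>n. V (?D n (?i n \<omega>)) \<omega>) \<longlonglongrightarrow> V (U \<omega>) \<omega>" if w: "\<omega> \<in> space M" for \<omega>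
  proof -
    have above: "U \<omega> < (of_int (?i n \<omega>) + 1) / real (Suc n)" for n
      by (simp add: field_simps del: of_nat_Suc) linarith
    have below: "(of_int (?i n \<omega>) + 1) / real (Suc n) \<le> U \<omega> + 1 / real (Suc n)" for n
      by (simp add: field_simps del: of_nat_Suc)
    show ?thesis
    \<comment> \<open>At \<open>\<tau>\<close> there is no right limit to appeal to, but the clipped
      times are then equal to \<open>\<tau>\<close>.\<close>
    proof (cases "U \<omega> = \<tau>")
      case True
      have "?D n (?i n \<omega>) = U \<omega>" for n
        using above[of n] True tau_pos by (simp del: of_nat_Suc)
      then show ?thesis by simp
    next
      case False
      with range[OF w] have U\<tau>: "0 \<le> U \<omega>" "U \<omega> < \<tau>" by auto
      have lim: "(\<lambda>n. ?D n (?i n \<omega>)) \<longlonglongrightarrow> U \<omega>"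
      proof (rule tendsto_sandwich[where f = "\<lambda>_. U \<omega>" and h = "\<lambda>n. U \<omega> + 1 / real (Suc n)"])
        show "(\<lambda>n. U \<omega> + 1 / real (Suc n)) \<longlonglongrightarrow> U \<omega>"
          using tendsto_add[OF tendsto_const LIMSEQ_inverse_real_of_nat, of "U \<omega>"]
          by (simp add: inverse_eq_divide)
        show "\<forall>\<^sub>F n in sequentially. U \<omega> \<le> ?D n (?i n \<omega>)"
          using above U\<tau> by (intro always_eventually allI) (simp add: less_imp_le del: of_nat_Suc)
        show "\<forall>\<^sub>F n in sequentially. ?D n (?i n \<omega>) \<le> U \<omega> + 1 / real (Suc n)"
          using below U\<tau> by (intro always_eventually allI) (auto intro: min.coboundedI2 simp del: of_nat_Suc)
      qed simp
      have "U \<omega> < ?D n (?i n \<omega>)" for n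
        using above[of n] U\<tau> by (auto simp: less_max_iff_disj simp del: of_nat_Suc)
      then have "\<forall>n. ?D n (?i n \<omega>) \<in> {U \<omega><..} \<and> ?D n (?i n \<omega>) \<noteq> U \<omega>"
        by (metis greaterThan_iff less_irrefl)
      with lim have "filterlim (\<lambda>n. ?D n (?i n \<omega>)) (at_right (U \<omega>)) sequentially"
        unfolding filterlim_at by (blast intro: always_eventually)
      from filterlim_compose[OF path_right[OF w U\<tau>] this] show ?thesis .
    qed
  qed
qed

text \<open>The times \<open>U - 1 / (n + 1)\<close>, clipped at \<open>0\<close>, approach
  \<open>U\<close> strictly from below. If \<open>U = 0\<close>, they all equal \<open>0\<close>, in
  agreement with the convention for the left limit there.\<close>

lemma measurable_left_limit:
  assumes U[measurable]: "U \<in> borel_measurable M"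
    and range: "\<And>\<omega>. \<omega> \<in> space M \<Longrightarrow> 0 \<le> U \<omega> \<and> U \<omega> \<le> \<tau>"
  shows "(\<lambda>\<omega>. left_limit V (U \<omega>) \<omega>) \<in> borel_measurable M"
proof (rule borel_measurable_LIMSEQ_real)
  let ?D = "\<lambda>n \<omega>. max 0 (U \<omega> - 1 / real (Suc n))"
  show "(\<lambda>\<omega>. V (?D n \<omega>) \<omega>) \<in> borel_measurable M" for n
  proof (intro measurable_stopped conjI)
    show "?D n \<omega> \<le> \<tau>" if "\<omega> \<in> space M" for \<omega>
      using range[OF that] tau_pos order_trans[of "U \<omega> - 1 / real (Suc n)" "U \<omega>" \<tau>]
      by (simp del: of_nat_Suc)
  qed auto
  show "(\<lambda>n. V (?D n \<omega>) \<omega>) \<longlonglongrightarrow> left_limit V (U \<omega>) \<omega>" if w: "\<omega> \<in> space M" for \<omega>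
  proof (cases "U \<omega> = 0")
    case True
    then show ?thesis by (simp add: left_limit_def)
  next
    case False
    with range[OF w] have U: "0 < U \<omega>" "U \<omega> \<le> \<tau>" by auto
    have "(\<lambda>n. max 0 (U \<omega> - 1 / real (Suc n))) \<longlonglongrightarrow> max 0 (U \<omega> - 0)"
      using LIMSEQ_inverse_real_of_nat
      by (intro tendsto_max tendsto_diff tendsto_const) (simp add: inverse_eq_divide)
    moreover have "?D n \<omega> < U \<omega>" for n
      using U by (simp del: of_nat_Suc)
    ultimately have "filterlim (\<lambda>n. ?D n \<omega>) (at_left (U \<omega>)) sequentially"
      using U by (auto simp: filterlim_at less_imp_neq simp del: of_nat_Suc)
    from filterlim_compose[OF path_left[OF w U] this] show ?thesis .
  qed
qed

section \<open>Increment bounds given the past of a stopping time\<close>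

text \<open>\<open>pre_sigma\<close> only controls the parts of \<open>A\<close> on which
  \<open>S \<le> t\<close>. For \<open>S\<close> bounded by a constant \<open>t\<close>, this part
  is all of \<open>A\<close>.\<close>

lemma subalgebra_pre_sigma:
  assumes "stopping_time F S"
    and "\<And>\<omega>. \<omega> \<in> space M \<Longrightarrow> S \<omega> \<le> t"
  shows "subalgebra M (pre_sigma S)"
proof -
  have "A \<in> sets M" if A: "A \<in> sets (pre_sigma S)" for A
  proof -
    have "A \<subseteq> space M"
      using sets.sets_into_space[OF A] by (simp add: space_pre_sigma)
    then have "{\<omega>\<in>A. S \<omega> \<le> t} = A" using assms(2) by auto
    then show ?thesis
      using sets_pre_sigmaD[OF assms(1) A, of t] sets_F_subset by auto
  qed
  then show ?thesis by (auto simp: subalgebra_def space_pre_sigma)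
qed

text \<open>The only access to the definition of \<open>rho\<close>: the essential supremum becomes
  an integrated bound over events known at time \<open>S\<close>.\<close>

lemma set_nn_integral_increment_le:
  assumes st: "0 \<le> s" "t \<le> \<tau>"
    and ST: "(S, T) \<in> stopping_pairs M F s t"
    and le: "rho M F V s t \<le> c"
    and A: "A \<in> sets (pre_sigma S)"
  shows "(\<integral>\<^sup>+\<omega>\<in>A. ennreal \<bar>V (T \<omega>) \<omega> - left_limit V (S \<omega>) \<omega>\<bar> \<partial>M) \<le> c * emeasure M A"
proof -
  let ?f = "\<lambda>\<omega>. ennreal \<bar>V (T \<omega>) \<omega> - left_limit V (S \<omega>) \<omega>\<bar>"
  have S: "stopping_time F S" and T: "stopping_time F T"
    and b: "\<And>\<omega>. \<omega> \<in> space M \<Longrightarrow> s \<le> S \<omega> \<and> S \<omega> \<le> T \<omega> \<and> T \<omega> \<le> t"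
    using ST by (auto simp: stopping_pairs_def)
  have "S \<in> borel_measurable M" "T \<in> borel_measurable M"
    using measurable_stopping_time[OF S sets_F_subset space_F]
      measurable_stopping_time[OF T sets_F_subset space_F] by auto
  then have [measurable]: "(\<lambda>\<omega>. V (T \<omega>) \<omega>) \<in> borel_measurable M"
    "(\<lambda>\<omega>. left_limit V (S \<omega>) \<omega>) \<in> borel_measurable M"
    using b st by (auto intro!: measurable_stopped measurable_left_limit) (meson order_trans)+
  have sub: "subalgebra M (pre_sigma S)"
    using b by (intro subalgebra_pre_sigma[OF S, of t]) (meson order_trans)
  interpret G: finite_measure_subalgebra M "pre_sigma S"
    by unfold_locales (rule sub)
  have "esssup M (nn_cond_exp M (pre_sigma S) ?f) \<le> rho M F V s t"
    unfolding rho_def by (rule SUP_upper2[OF ST]) simp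
  then have "AE \<omega> in M. nn_cond_exp M (pre_sigma S) ?f \<omega> \<le> c"
    using esssup_AE[of "nn_cond_exp M (pre_sigma S) ?f" M] le by (auto intro: order_trans)
  from G.nn_integral_mult_le_of_nn_cond_exp_le[OF _ _ this, of "indicator A"]
  show ?thesis
    using A sub by (auto simp: subalgebra_def mult.commute)
qed

section \<open>The oscillation from the left end of an interval\<close>

text \<open>Increments are counted from \<open>V s\<close>, so that \<open>osc r \<tau>\<close> is
  the supremum inside \<open>cond_exp_moment\<close>.\<close>

definition osc :: "real \<Rightarrow> real \<Rightarrow> 'a \<Rightarrow> real" where
  "osc s t \<omega> = (SUP u\<in>{s..t}. \<bar>V u \<omega> - V s \<omega>\<bar>)"

lemma bdd_above_osc:
  assumes "\<omega> \<in> space M" "0 \<le> s" "t \<le> \<tau>"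
  shows "bdd_above ((\<lambda>u. \<bar>V u \<omega> - V s \<omega>\<bar>) ` {s..t})"
proof -
  obtain B where B: "\<forall>u\<in>{0..\<tau>}. \<bar>V u \<omega>\<bar> \<le> B"
    using path_bounded[OF assms(1)] by blast
  show ?thesis
  proof (rule bdd_aboveI2)
    fix u assume "u \<in> {s..t}"
    then have "\<bar>V u \<omega>\<bar> \<le> B" "\<bar>V s \<omega>\<bar> \<le> B" using B assms by auto
    then show "\<bar>V u \<omega> - V s \<omega>\<bar> \<le> 2 * B" by linarith
  qed
qed

lemma less_osc_iff:
  assumes "\<omega> \<in> space M" "0 \<le> s" "s \<le> t" "t \<le> \<tau>"
  shows "b < osc s t \<omega> \<longleftrightarrow> (\<exists>u\<in>{s..t}. b < \<bar>V u \<omega> - V s \<omega>\<bar>)"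
  unfolding osc_def using assms by (intro less_cSUP_iff bdd_above_osc) auto

lemma osc_nonneg:
  assumes "\<omega> \<in> space M" "0 \<le> s" "s \<le> t" "t \<le> \<tau>"
  shows "0 \<le> osc s t \<omega>"
proof -
  have "\<bar>V s \<omega> - V s \<omega>\<bar> \<le> osc s t \<omega>"
    unfolding osc_def using assms by (intro cSUP_upper bdd_above_osc) auto
  then show ?thesis by simp
qed

text \<open>An increment reaching beyond \<open>m\<close> is split at \<open>V m\<close>. This
  subadditivity makes exponentials multiply along consecutive intervals.\<close>

lemma osc_le_add:
  assumes w: "\<omega> \<in> space M" and "0 \<le> s" "s \<le> m" "m \<le> t" "t \<le> \<tau>"
  shows "osc s t \<omega> \<le> osc s m \<omega> + osc m t \<omega>"
proof -
  have le1: "\<bar>V u \<omega> - V s \<omega>\<bar> \<le> osc s m \<omega>" if "u \<in> {s..m}" for u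
    unfolding osc_def using that assms by (intro cSUP_upper bdd_above_osc) auto
  have le2: "\<bar>V u \<omega> - V m \<omega>\<bar> \<le> osc m t \<omega>" if "u \<in> {m..t}" for u
    unfolding osc_def using that assms by (intro cSUP_upper bdd_above_osc) auto
  have "\<bar>V u \<omega> - V s \<omega>\<bar> \<le> osc s m \<omega> + osc m t \<omega>" if u: "u \<in> {s..t}" for u
  proof (cases "u \<le> m")
    case True
    then show ?thesis using le1[of u] u osc_nonneg[OF w, of m t] assms by auto
  next
    case False
    then show ?thesis using le2[of u] le1[of m] u assms by auto
  qed
  then show ?thesis
    unfolding osc_def[of s t] using assms by (intro cSUP_least) auto
qed

text \<open>By right continuity a strict exceedance at \<open>u\<close> persists just after
  \<open>u\<close>. The half-open interval leaves room there for a rational time.\<close>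

lemma exceeds_before_iff_rational:
  assumes w: "\<omega> \<in> space M" and s: "0 \<le> s" and v: "v \<le> \<tau>"
  shows "(\<exists>u\<in>{s..<v}. b < \<bar>V u \<omega> - V s \<omega>\<bar>) \<longleftrightarrow> (\<exists>q\<in>\<rat> \<inter> {s..<v}. b < \<bar>V q \<omega> - V s \<omega>\<bar>)"
proof
  assume "\<exists>u\<in>{s..<v}. b < \<bar>V u \<omega> - V s \<omega>\<bar>"
  then obtain u where u: "s \<le> u" "u < v" "b < \<bar>V u \<omega> - V s \<omega>\<bar>" by auto
  have "((\<lambda>r. \<bar>V r \<omega> - V s \<omega>\<bar>) \<longlongrightarrow> \<bar>V u \<omega> - V s \<omega>\<bar>) (at_right u)"
    using u s v by (intro tendsto_intros path_right[OF w]) auto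
  from order_tendstoD(1)[OF this u(3)]
  obtain y where y: "u < y" "\<And>r. u < r \<Longrightarrow> r < y \<Longrightarrow> b < \<bar>V r \<omega> - V s \<omega>\<bar>"
    by (auto simp: eventually_at_right[OF u(2)])
  obtain q where "q \<in> \<rat>" "u < q" "q < min y v"
    using Rats_dense_in_real[of u "min y v"] y(1) u(2) by auto
  then show "\<exists>q\<in>\<rat> \<inter> {s..<v}. b < \<bar>V q \<omega> - V s \<omega>\<bar>"
    using y(2) u by (intro bexI[of _ q]) auto
qed auto

lemma pred_exceeds_before:
  assumes s: "0 \<le> s" and v: "v \<le> \<tau>"
  shows "Measurable.pred (F v) (\<lambda>\<omega>. \<exists>u\<in>{s..<v}. b < \<bar>V u \<omega> - V s \<omega>\<bar>)"
proof -
  have "Measurable.pred (F v) (\<lambda>\<omega>. \<exists>q\<in>\<rat> \<inter> {s..<v}. b < \<bar>V q \<omega> - V s \<omega>\<bar>)"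
  proof (intro measurable_pred_countable)
    show "countable (\<rat> \<inter> {s..<v})"
      using countable_rat by (rule countable_subset[rotated]) auto
    fix q assume "q \<in> \<rat> \<inter> {s..<v}"
    then have [measurable]: "V q \<in> borel_measurable (F v)" "V s \<in> borel_measurable (F v)"
      using s v by (auto intro!: adapted_later)
    show "Measurable.pred (F v) (\<lambda>\<omega>. b < \<bar>V q \<omega> - V s \<omega>\<bar>)"
      by measurable
  qed
  then show ?thesis
    using exceeds_before_iff_rational[OF _ s v]
    by (subst measurable_cong) (auto simp: space_F)
qed

lemma measurable_osc:
  assumes "0 \<le> s" "s \<le> t" "t \<le> \<tau>"
  shows "osc s t \<in> borel_measurable (F t)"
proof (rule borel_measurableI_greater)
  fix b
  have [measurable]: "V t \<in> borel_measurable (F t)" "V s \<in> borel_measurable (F t)"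
    using assms by (auto intro!: adapted_later)
  note [measurable] = pred_exceeds_before[OF assms(1,3), of b]
  \<comment> \<open>A jump at \<open>t\<close> may be the only exceedance, and rational times before
    \<open>t\<close> would miss it.\<close>
  have split: "{s..t} = insert t {s..<t}" using assms by auto
  have "Measurable.pred (F t) (\<lambda>\<omega>. b < \<bar>V t \<omega> - V s \<omega>\<bar> \<or> (\<exists>u\<in>{s..<t}. b < \<bar>V u \<omega> - V s \<omega>\<bar>))"
    by measurable
  then show "{\<omega> \<in> space (F t). b < osc s t \<omega>} \<in> sets (F t)"
    unfolding pred_def using less_osc_iff[OF _ assms, of _ b]
    by (auto simp: space_F split cong: conj_cong)
qed

subsection \<open>Hitting times and the tail of the oscillation\<close>

text \<open>Inserting \<open>t\<close> keeps the set nonempty and gives the value \<open>t\<close>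
  when the level is never exceeded.\<close>

definition hit :: "real \<Rightarrow> real \<Rightarrow> real \<Rightarrow> 'a \<Rightarrow> real" where
  "hit s t b \<omega> = Inf (insert t {u\<in>{s..t}. b < \<bar>V u \<omega> - V s \<omega>\<bar>})"

lemma bdd_below_hit: "bdd_below (insert t {u\<in>{s..t}. b < \<bar>V u \<omega> - V s \<omega>\<bar>})"
  by (rule bdd_belowI[of _ "min s t"]) auto

lemma hit_bounds: "s \<le> t \<Longrightarrow> s \<le> hit s t b \<omega>" "hit s t b \<omega> \<le> t"
  unfolding hit_def by (auto intro!: cInf_greatest cInf_lower bdd_below_hit)

text \<open>The inserted default \<open>t\<close> is not below \<open>v\<close>, so only genuine
  exceedances count.\<close>

lemma hit_less_iff:
  assumes "v \<le> t"
  shows "hit s t b \<omega> < v \<longleftrightarrow> (\<exists>u\<in>{s..<v}. b < \<bar>V u \<omega> - V s \<omega>\<bar>)"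
proof -
  have "hit s t b \<omega> < v \<longleftrightarrow> (\<exists>u\<in>insert t {u\<in>{s..t}. b < \<bar>V u \<omega> - V s \<omega>\<bar>}. u < v)"
    unfolding hit_def by (intro cInf_less_iff bdd_below_hit) auto
  then show ?thesis using assms by auto
qed

lemma hit_mono: "b \<le> b' \<Longrightarrow> hit s t b \<omega> \<le> hit s t b' \<omega>"
  unfolding hit_def by (rule cInf_superset_mono) (auto intro: bdd_below_hit)

text \<open>Events \<open>hit < v\<close> are decided by time \<open>v\<close>. The event
  \<open>hit \<le> y\<close> is a countable intersection of these with \<open>v\<close> decreasing
  to \<open>y\<close>, so it lies in every later sigma-algebra and, by right continuity of the
  filtration, in \<open>F y\<close>.\<close>

lemma stopping_time_hit:
  assumes s: "0 \<le> s" "s \<le> t" and t: "t \<le> \<tau>"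
  shows "stopping_time F (hit s t b)"
proof (rule stopping_timeI)
  fix y
  consider "y < s" | "t \<le> y" | "s \<le> y" "y < t" by linarith
  then show "Measurable.pred (F y) (\<lambda>\<omega>. hit s t b \<omega> \<le> y)"
  proof cases
    case 1
    then have "\<not> hit s t b \<omega> \<le> y" for \<omega>
      using hit_bounds(1)[OF s(2), of b \<omega>] by simp
    then show ?thesis by simp
  next
    case 2
    then have "hit s t b \<omega> \<le> y" for \<omega>
      using hit_bounds(2)[of s t b \<omega>] by simp
    then show ?thesis by simp
  next
    case 3
    have "{\<omega>\<in>space M. hit s t b \<omega> \<le> y} \<in> sets (F z)" if z: "y < z" for z
    proof -
      define m where "m = min t z"
      \<comment> \<open>All \<open>v n\<close> stay in \<open>(y, min t z]\<close>: at most
        \<open>z\<close> for measurability in \<open>F z\<close>, and at most \<open>t\<close> for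
        \<open>hit_less_iff\<close>.\<close>
      define v where "v n = y + (m - y) / real (Suc n)" for n
      have pos: "0 < m - y" using z 3 by (simp add: m_def)
      have v: "y < v n" "v n \<le> m" for n
      proof -
        show "y < v n" using pos by (simp add: v_def del: of_nat_Suc)
        have "(m - y) / real (Suc n) \<le> (m - y) / 1"
          using pos by (intro divide_left_mono) auto
        then show "v n \<le> m" by (simp add: v_def del: of_nat_Suc)
      qed
      have "v \<longlonglongrightarrow> y + (m - y) * 0"
        unfolding v_def divide_inverse
        by (intro tendsto_intros LIMSEQ_inverse_real_of_nat)
      then have lim: "v \<longlonglongrightarrow> y" by simp
      have "hit s t b \<omega> \<le> y \<longleftrightarrow> (\<forall>n. hit s t b \<omega> < v n)" for \<omega>
      proof
        assume "\<forall>n. hit s t b \<omega> < v n"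
        then show "hit s t b \<omega> \<le> y"
          using lim by (intro LIMSEQ_le_const) (auto intro: less_imp_le)
      qed (use v(1) le_less_trans in blast)
      moreover have "hit s t b \<omega> < v n \<longleftrightarrow> (\<exists>u\<in>{s..<v n}. b < \<bar>V u \<omega> - V s \<omega>\<bar>)" for \<omega> n
        using v(2)[of n] by (intro hit_less_iff) (simp add: m_def)
      ultimately have "{\<omega>\<in>space M. hit s t b \<omega> \<le> y} =
          (\<Inter>n. {\<omega>\<in>space M. \<exists>u\<in>{s..<v n}. b < \<bar>V u \<omega> - V s \<omega>\<bar>})"
        by auto
      moreover have "{\<omega>\<in>space M. \<exists>u\<in>{s..<v n}. b < \<bar>V u \<omega> - V s \<omega>\<bar>} \<in> sets (F z)" for n
      proof -
        have "v n \<le> z" "v n \<le> \<tau>" using v(2)[of n] t by (auto simp: m_def)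
        then show ?thesis
          using pred_exceeds_before[OF s(1), of "v n" b] sets_F_mono[of "v n" z]
          by (auto simp: pred_def space_F)
      qed
      ultimately show ?thesis by auto
    qed
    then have "{\<omega>\<in>space M. hit s t b \<omega> \<le> y} \<in> (\<Inter>z\<in>{y<..}. sets (F z))" by auto
    then show ?thesis
      using right_continuous_F[of y] 3 s by (simp add: pred_def space_F)
  qed
qed

text \<open>A hit before \<open>t\<close> already certifies the exceedance, and from time
  \<open>t\<close> on the oscillation is known. Keeping a factor \<open>A\<close> from
  \<open>F s\<close> makes the later tail estimates conditional on \<open>F s\<close>.\<close>

lemma less_osc_in_pre_sigma_hit:
  assumes st: "0 \<le> s" "s \<le> t" "t \<le> \<tau>" and A: "A \<in> sets (F s)"
  shows "{\<omega>\<in>A. b < osc s t \<omega>} \<in> sets (pre_sigma (hit s t b))"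
proof (rule sets_pre_sigmaI[OF stopping_time_hit[OF st]])
  fix y
  have AM: "A \<subseteq> space M"
    using sets.sets_into_space[OF A] by (simp add: space_F)
  consider "y < s" | "t \<le> y" | "s \<le> y" "y < t" by linarith
  then show "{\<omega> \<in> {\<omega> \<in> A. b < osc s t \<omega>}. hit s t b \<omega> \<le> y} \<in> sets (F y)"
  proof cases
    case 1
    then have "\<not> hit s t b \<omega> \<le> y" for \<omega>
      using hit_bounds(1)[OF st(2), of b \<omega>] by simp
    then show ?thesis by simp
  next
    case 2
    have "{\<omega>\<in>space (F y). b < osc s t \<omega>} \<in> sets (F y)"
      using measurable_F_mono[OF measurable_osc[OF st] 2] by measurable
    moreover have "A \<in> sets (F y)"
      using A sets_F_mono[of s y] 2 st by auto
    moreover have "{\<omega> \<in> {\<omega> \<in> A. b < osc s t \<omega>}. hit s t b \<omega> \<le> y} = A \<inter> {\<omega>\<in>space (F y). b < osc s t \<omega>}"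
      using AM 2 by (auto simp: space_F intro: order_trans[OF hit_bounds(2)])
    ultimately show ?thesis by auto
  next
    case 3
    have "b < osc s t \<omega>" if "\<omega> \<in> A" "hit s t b \<omega> \<le> y" for \<omega>
    proof -
      have "hit s t b \<omega> < t" using that 3 by simp
      then show ?thesis
        using that AM by (subst less_osc_iff[OF _ st]) (auto simp: hit_less_iff)
    qed
    then have "{\<omega> \<in> {\<omega> \<in> A. b < osc s t \<omega>}. hit s t b \<omega> \<le> y} = A \<inter> {\<omega>\<in>space (F y). hit s t b \<omega> \<le> y}"
      using AM by (auto simp: space_F)
    moreover have "A \<in> sets (F y)"
      using A sets_F_mono[of s y] 3 by auto
    ultimately show ?thesis
      using stopping_timeD[OF stopping_time_hit[OF st], of b y] by (auto simp: pred_def)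
  qed
qed

text \<open>A value below \<open>b\<close> at the hitting time would, by right continuity, exclude
  exceedances shortly afterwards and contradict the infimum.\<close>

lemma value_at_hit_ge:
  assumes w: "\<omega> \<in> space M" and st: "0 \<le> s" "s \<le> t" "t \<le> \<tau>" and b: "b < osc s t \<omega>"
  shows "b \<le> \<bar>V (hit s t b \<omega>) \<omega> - V s \<omega>\<bar>"
proof (rule ccontr)
  let ?T = "hit s t b \<omega>"
  assume *: "\<not> b \<le> \<bar>V ?T \<omega> - V s \<omega>\<bar>"
  obtain u where u: "u \<in> {s..t}" "b < \<bar>V u \<omega> - V s \<omega>\<bar>"
    using b less_osc_iff[OF w st] by auto
  \<comment> \<open>Needed to have a right neighbourhood inside the interval. If
    \<open>?T = t\<close>, the exceedance point \<open>u\<close> would be \<open>t\<close> itself,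
    against the assumption on the value there.\<close>
  have "?T < t"
  proof (rule ccontr)
    assume "\<not> ?T < t"
    then have "?T = t" using hit_bounds(2)[of s t b \<omega>] by simp
    moreover have "?T \<le> u"
      unfolding hit_def using u by (intro cInf_lower bdd_below_hit) auto
    ultimately show False using u * by auto
  qed
  have "((\<lambda>r. \<bar>V r \<omega> - V s \<omega>\<bar>) \<longlongrightarrow> \<bar>V ?T \<omega> - V s \<omega>\<bar>) (at_right ?T)"
    using \<open>?T < t\<close> st hit_bounds(1)[OF st(2), of b \<omega>]
    by (intro tendsto_intros path_right[OF w]) auto
  from order_tendstoD(2)[OF this, of b] *
  obtain y where y: "?T < y" "\<And>r. ?T < r \<Longrightarrow> r < y \<Longrightarrow> \<bar>V r \<omega> - V s \<omega>\<bar> < b"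
    by (auto simp: eventually_at_right[OF \<open>?T < t\<close>])
  have "?T < min y t" using y(1) \<open>?T < t\<close> by simp
  then obtain r where r: "r \<in> {s..<min y t}" "b < \<bar>V r \<omega> - V s \<omega>\<bar>"
    using hit_less_iff[of "min y t" t s b \<omega>] by auto
  then have "?T \<le> r"
    unfolding hit_def by (intro cInf_lower bdd_below_hit) auto
  then show False
    using r * y(2)[of r] by (cases "r = ?T") auto
qed

text \<open>No time in \<open>[s, hit)\<close> exceeds the level, and the weak inequality passes to
  the left limit.\<close>

lemma left_limit_at_hit_le:
  assumes w: "\<omega> \<in> space M" and st: "0 \<le> s" "s \<le> t" "t \<le> \<tau>" and b: "0 < b" "b < osc s t \<omega>"
  shows "\<bar>left_limit V (hit s t b \<omega>) \<omega> - V s \<omega>\<bar> \<le> b"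
proof -
  let ?T = "hit s t b \<omega>"
  \<comment> \<open>The increment is \<open>0 < b\<close> at time \<open>s\<close> but at least
    \<open>b\<close> at the hitting time.\<close>
  have sT: "s < ?T"
    using value_at_hit_ge[OF w st b(2)] hit_bounds(1)[OF st(2), of b \<omega>] b(1)
    by (cases "s = ?T") auto
  have T: "?T \<le> t" by (rule hit_bounds)
  have "((\<lambda>r. \<bar>V r \<omega> - V s \<omega>\<bar>) \<longlongrightarrow> \<bar>left_limit V ?T \<omega> - V s \<omega>\<bar>) (at_left ?T)"
    using sT T st by (intro tendsto_intros path_left[OF w]) auto
  moreover have "\<forall>\<^sub>F r in at_left ?T. \<bar>V r \<omega> - V s \<omega>\<bar> \<le> b"
    unfolding eventually_at_left[OF sT]
  proof (intro exI conjI allI impI)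
    show "s < ?T" by fact
    fix r assume r: "s < r" "r < ?T"
    show "\<bar>V r \<omega> - V s \<omega>\<bar> \<le> b"
    proof (rule ccontr)
      assume "\<not> \<bar>V r \<omega> - V s \<omega>\<bar> \<le> b"
      then have "?T \<le> r"
        unfolding hit_def using r T by (intro cInf_lower bdd_below_hit) auto
      with r show False by simp
    qed
  qed
  ultimately show ?thesis
    by (rule tendsto_upperbound) simp
qed

text \<open>The positivity of \<open>b\<close> forces \<open>s < hit s t b \<omega>\<close>, so that a jump of \<open>V\<close> at \<open>s\<close>, which is seen by
  \<^const>\<open>rho\<close> but not by \<^const>\<open>osc\<close>, plays no role.\<close>

lemma emeasure_less_osc_step:
  assumes st: "0 \<le> s" "s \<le> t" "t \<le> \<tau>" and A: "A \<in> sets (F s)"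
    and b: "0 < b" and c: "0 < c" and rho: "rho M F V s t \<le> ennreal c"
  shows "emeasure M {\<omega>\<in>A. b + 2 * c < osc s t \<omega>} \<le> ennreal (1 / 2) * emeasure M {\<omega>\<in>A. b < osc s t \<omega>}"
proof -
  let ?S = "hit s t b" and ?T = "hit s t (b + 2 * c)"
  let ?B = "{\<omega>\<in>A. b < osc s t \<omega>}" and ?C = "{\<omega>\<in>A. b + 2 * c < osc s t \<omega>}"
  have AM: "A \<subseteq> space M"
    using sets.sets_into_space[OF A] by (simp add: space_F)
  have meas: "{\<omega>\<in>A. x < osc s t \<omega>} \<in> sets M" for x
    using less_osc_in_pre_sigma_hit[OF st A, of x] hit_bounds(2)
      subalgebra_pre_sigma[OF stopping_time_hit[OF st], of x t] by (auto simp: subalgebra_def)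
  have pair: "(?S, ?T) \<in> stopping_pairs M F s t"
    using stopping_time_hit[OF st] hit_bounds(1)[OF st(2)] hit_bounds(2) c
    by (auto simp: stopping_pairs_def intro: hit_mono)
  have "ennreal (2 * c) * emeasure M ?C = (\<integral>\<^sup>+\<omega>\<in>?C. ennreal (2 * c) \<partial>M)"
    using meas by (simp add: nn_integral_cmult_indicator)
  also have "\<dots> \<le> (\<integral>\<^sup>+\<omega>\<in>?B. ennreal \<bar>V (?T \<omega>) \<omega> - left_limit V (?S \<omega>) \<omega>\<bar> \<partial>M)"
  proof (rule nn_integral_mono)
    fix \<omega> assume w: "\<omega> \<in> space M"
    have "2 * c \<le> \<bar>V (?T \<omega>) \<omega> - left_limit V (?S \<omega>) \<omega>\<bar>" if "b + 2 * c < osc s t \<omega>"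
    proof -
      have "b < osc s t \<omega>" using that c by simp
      then show ?thesis
        using value_at_hit_ge[OF w st that] left_limit_at_hit_le[OF w st b] by linarith
    qed
    then show "ennreal (2 * c) * indicator ?C \<omega>
        \<le> ennreal \<bar>V (?T \<omega>) \<omega> - left_limit V (?S \<omega>) \<omega>\<bar> * indicator ?B \<omega>"
      using c by (auto simp: indicator_def intro: ennreal_leI)
  qed
  \<comment> \<open>The integral was enlarged from \<open>?C\<close> to \<open>?B\<close> because
    \<open>?B\<close> is known at time \<open>?S\<close>; its probability is what appears on the
    right.\<close>
  also have "\<dots> \<le> ennreal c * emeasure M ?B"
    using st pair rho less_osc_in_pre_sigma_hit[OF st A]
    by (intro set_nn_integral_increment_le) auto
  finally have "2 * c * measure M ?C \<le> c * measure M ?B"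
    using c by (simp add: emeasure_eq_measure ennreal_mult'[symmetric])
  then have "measure M ?C \<le> 1 / 2 * measure M ?B"
    using c by (simp add: mult.assoc mult.left_commute)
  then show ?thesis
    by (simp add: emeasure_eq_measure ennreal_mult'[symmetric] ennreal_leI del: ennreal_half)
qed

text \<open>Iterates the halving step. That step needs a positive level, so the iteration starts at
  \<open>2 * c\<close> with the trivial bound; hence \<open>Suc j\<close> levels but only
  \<open>j\<close> halvings.\<close>

lemma emeasure_less_osc_le:
  assumes st: "0 \<le> s" "s \<le> t" "t \<le> \<tau>" and A: "A \<in> sets (F s)"
    and c: "0 < c" and rho: "rho M F V s t \<le> ennreal c"
  shows "emeasure M {\<omega>\<in>A. real (Suc j) * (2 * c) < osc s t \<omega>} \<le> ennreal ((1 / 2) ^ j) * emeasure M A"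
proof (induction j)
  case 0
  have "A \<in> sets M" using A sets_F_subset by auto
  then show ?case by (auto intro!: emeasure_mono)
next
  case (Suc j)
  have "{\<omega>\<in>A. real (Suc (Suc j)) * (2 * c) < osc s t \<omega>} =
      {\<omega>\<in>A. real (Suc j) * (2 * c) + 2 * c < osc s t \<omega>}"
    by (simp add: algebra_simps)
  then have "emeasure M {\<omega>\<in>A. real (Suc (Suc j)) * (2 * c) < osc s t \<omega>}
      \<le> ennreal (1 / 2) * emeasure M {\<omega>\<in>A. real (Suc j) * (2 * c) < osc s t \<omega>}"
    using emeasure_less_osc_step[OF st A _ c rho, of "real (Suc j) * (2 * c)"] c
    by (simp del: ennreal_half)
  also have "\<dots> \<le> ennreal (1 / 2) * (ennreal ((1 / 2) ^ j) * emeasure M A)"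
    by (intro mult_left_mono Suc.IH) simp
  also have "\<dots> = ennreal ((1 / 2) ^ Suc j) * emeasure M A"
    by (simp add: mult.assoc[symmetric] ennreal_mult'[symmetric] del: ennreal_half)
  finally show ?case .
qed

subsection \<open>Conditional exponential moments\<close>

text \<open>The almost sure bound \<open>K\<close> on the conditional exponential moment given
  \<open>F s\<close>, in integrated form, which avoids handling versions and null sets.\<close>

definition exp_bound :: "real \<Rightarrow> real \<Rightarrow> real \<Rightarrow> ennreal \<Rightarrow> bool" where
  "exp_bound \<beta> s t K \<longleftrightarrow>
     (\<forall>A\<in>sets (F s). (\<integral>\<^sup>+\<omega>\<in>A. ennreal (exp (\<beta> * osc s t \<omega>)) \<partial>M) \<le> K * emeasure M A)"

lemma exp_bound_mono: "exp_bound \<beta> s t K \<Longrightarrow> K \<le> K' \<Longrightarrow> exp_bound \<beta> s t K'"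
  unfolding exp_bound_def by (meson mult_right_mono order_trans zero_le)

lemma measurable_exp_osc:
  assumes "0 \<le> s" "s \<le> t" "t \<le> \<tau>"
  shows "(\<lambda>\<omega>. ennreal (exp (\<beta> * osc s t \<omega>))) \<in> borel_measurable (F t)"
  using measurable_osc[OF assms] by measurable

lemma exp_bound_imp_AE:
  assumes st: "0 \<le> s" "s \<le> t" "t \<le> \<tau>" and K: "exp_bound \<beta> s t K"
  shows "AE \<omega> in M. nn_cond_exp M (F s) (\<lambda>\<omega>. ennreal (exp (\<beta> * osc s t \<omega>))) \<omega> \<le> K"
proof -
  interpret G: finite_measure_subalgebra M "F s"
    by unfold_locales (rule subalgebra_F)
  show ?thesis
    using K measurable_from_subalg[OF subalgebra_F measurable_exp_osc[OF st]]
    by (intro G.AE_nn_cond_exp_le) (auto simp: exp_bound_def emeasure_space_1)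
qed

text \<open>The tower property: the exponential over \<open>[s, m]\<close> is known at time
  \<open>m\<close> and acts as a weight for the one over \<open>[m, t]\<close>.\<close>

lemma exp_bound_chain:
  assumes st: "0 \<le> s" "s \<le> m" "m \<le> t" "t \<le> \<tau>" and lam: "0 < \<beta>"
    and K: "exp_bound \<beta> s m K" and K': "exp_bound \<beta> m t K'"
  shows "exp_bound \<beta> s t (K' * K)"
  unfolding exp_bound_def
proof
  fix A assume A: "A \<in> sets (F s)"
  let ?f = "\<lambda>\<omega>. ennreal (exp (\<beta> * osc m t \<omega>))"
  let ?g = "\<lambda>\<omega>. ennreal (exp (\<beta> * osc s m \<omega>)) * indicator A \<omega>"
  interpret G: finite_measure_subalgebra M "F m"
    by unfold_locales (rule subalgebra_F)
  have "A \<in> sets (F m)" using A sets_F_mono[of s m] st by auto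
  then have g: "?g \<in> borel_measurable (F m)"
    using measurable_exp_osc[of s m \<beta>] st
    by (intro borel_measurable_times_ennreal borel_measurable_indicator) auto
  have f: "?f \<in> borel_measurable M"
    using measurable_from_subalg[OF subalgebra_F measurable_exp_osc[of m t \<beta>]] st by auto
  have "(\<integral>\<^sup>+\<omega>\<in>A. ennreal (exp (\<beta> * osc s t \<omega>)) \<partial>M) \<le> (\<integral>\<^sup>+\<omega>. ?g \<omega> * ?f \<omega> \<partial>M)"
  proof (rule nn_integral_mono)
    fix \<omega> assume "\<omega> \<in> space M"
    then have "\<beta> * osc s t \<omega> \<le> \<beta> * osc s m \<omega> + \<beta> * osc m t \<omega>"
      using osc_le_add[of \<omega> s m t] st lam by (simp add: distrib_left[symmetric])
    then show "ennreal (exp (\<beta> * osc s t \<omega>)) * indicator A \<omega> \<le> ?g \<omega> * ?f \<omega>"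
      by (auto simp: indicator_def ennreal_mult'[symmetric] exp_add[symmetric] intro!: ennreal_leI)
  qed
  also have "\<dots> \<le> K' * (\<integral>\<^sup>+\<omega>. ?g \<omega> \<partial>M)"
    using st K' by (intro G.nn_integral_mult_le_of_nn_cond_exp_le f g exp_bound_imp_AE) auto
  also have "\<dots> \<le> K' * (K * emeasure M A)"
    using K A by (intro mult_left_mono) (auto simp: exp_bound_def)
  finally show "(\<integral>\<^sup>+\<omega>\<in>A. ennreal (exp (\<beta> * osc s t \<omega>)) \<partial>M) \<le> K' * K * emeasure M A"
    by (simp add: mult.assoc)
qed

text \<open>Each level of height \<open>2 * c\<close> costs a factor
  \<open>exp (1 / 11) \<le> 11 / 10\<close> in the exponential, while the tail halves. The resulting
  series has ratio \<open>11 / 20\<close>.\<close>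

lemma exp_bound_if_rho_le:
  assumes st: "0 \<le> s" "s \<le> t" "t \<le> \<tau>" and lam: "0 < \<beta>"
    and rho: "rho M F V s t \<le> ennreal (1 / (22 * \<beta>))"
  shows "exp_bound \<beta> s t (ennreal (7 / 5))"
  unfolding exp_bound_def
proof
  fix A assume A: "A \<in> sets (F s)"
  define c where "c = 1 / (22 * \<beta>)"
  have c: "0 < c" and lc: "\<beta> * (2 * c) = 1 / 11" using lam by (auto simp: c_def)
  define E where "E j = {\<omega>\<in>A. real (Suc j) * (2 * c) < osc s t \<omega>}" for j
  have AM: "A \<in> sets M" using A sets_F_subset by auto
  have EM: "E j \<in> sets M" for j
    using less_osc_in_pre_sigma_hit[OF st A, of "real (Suc j) * (2 * c)"] hit_bounds(2)
      subalgebra_pre_sigma[OF stopping_time_hit[OF st], of "real (Suc j) * (2 * c)" t]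
    by (auto simp: subalgebra_def E_def simp del: of_nat_Suc)
  \<comment> \<open>From \<open>1 + x \<le> exp x\<close> at \<open>x = - 1 / 11\<close>; inverting
    gives the upper bound.\<close>
  have "10 / 11 \<le> exp (- (1 / 11) :: real)"
    using exp_ge_add_one_self[of "- (1 / 11)"] by simp
  then have exp_le: "exp (1 / 11 :: real) \<le> 11 / 10"
    by (simp add: exp_minus field_simps)
  \<comment> \<open>A telescoping sum: the summand is the difference of the powers with exponents
    \<open>Suc (Suc j)\<close> and \<open>Suc j\<close>.\<close>
  have geom: "(11 / 10 :: real) ^ Suc n = 11 / 10 + (\<Sum>j<n. 11 / 100 * (11 / 10) ^ j)" for n
    by (induction n) auto
  \<comment> \<open>Summation by parts of \<open>(11/10)\<^sup>n\<close> over the levels \<open>2cn\<close>; by \<open>exp_le\<close> this dominates the exponential.\<close>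
  have pointwise: "ennreal (exp (\<beta> * osc s t \<omega>)) * indicator A \<omega> \<le>
      ennreal (11 / 10) * indicator A \<omega> + (\<Sum>j. ennreal (11 / 100 * (11 / 10) ^ j) * indicator (E j) \<omega>)"
    for \<omega>
  proof (cases "\<omega> \<in> A")
    case True
    \<comment> \<open>By minimality, all levels with index below \<open>n\<close> are exceeded, so
      \<omega> lies in the corresponding \<open>E j\<close>.\<close>
    define n where "n = (LEAST n. osc s t \<omega> \<le> real (Suc n) * (2 * c))"
    obtain m where "osc s t \<omega> < real m * (2 * c)"
      using reals_Archimedean3[of "2 * c"] c by auto
    also have "\<dots> \<le> real (Suc m) * (2 * c)" using c by (intro mult_right_mono) auto
    finally have "osc s t \<omega> \<le> real (Suc m) * (2 * c)" by simp
    then have n: "osc s t \<omega> \<le> real (Suc n) * (2 * c)"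
      unfolding n_def by (rule LeastI)
    have E: "\<omega> \<in> E j" if "j < n" for j
      using not_less_Least[OF that[unfolded n_def]] True by (simp add: E_def not_le)
    have "\<beta> * osc s t \<omega> \<le> \<beta> * (real (Suc n) * (2 * c))"
      using n lam by (intro mult_left_mono) auto
    also have "\<dots> = real (Suc n) * (1 / 11)"
      by (simp only: lc[symmetric] mult_ac)
    finally have "exp (\<beta> * osc s t \<omega>) \<le> exp (real (Suc n) * (1 / 11))" by simp
    also have "\<dots> = exp (1 / 11) ^ Suc n" by (rule exp_of_nat_mult)
    also have "\<dots> \<le> (11 / 10) ^ Suc n"
      using exp_le by (rule power_mono) simp
    finally have "ennreal (exp (\<beta> * osc s t \<omega>)) \<le>
        ennreal (11 / 10 + (\<Sum>j<n. 11 / 100 * (11 / 10) ^ j))"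
      unfolding geom by (rule ennreal_leI)
    also have "\<dots> = ennreal (11 / 10) + (\<Sum>j<n. ennreal (11 / 100 * (11 / 10) ^ j))"
      by (subst ennreal_plus) (auto intro!: sum_nonneg simp: sum_ennreal)
    also have "(\<Sum>j<n. ennreal (11 / 100 * (11 / 10) ^ j)) =
        (\<Sum>j<n. ennreal (11 / 100 * (11 / 10) ^ j) * indicator (E j) \<omega>)"
      using E by (intro sum.cong) auto
    also have "\<dots> \<le> (\<Sum>j. ennreal (11 / 100 * (11 / 10) ^ j) * indicator (E j) \<omega>)"
      by (intro sum_le_suminf) auto
    finally show ?thesis using True by (simp add: add_left_mono)
  qed simp
  have "(\<lambda>j. 11 / 100 * (11 / 20) ^ j) sums (11 / 100 * (1 / (1 - 11 / 20 :: real)))"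
    by (intro sums_mult geometric_sums) simp
  then have series: "(\<Sum>j. ennreal (11 / 100 * (11 / 20) ^ j)) = ennreal (11 / 45)"
    by (intro suminf_ennreal_eq) auto
  have "(\<integral>\<^sup>+\<omega>\<in>A. ennreal (exp (\<beta> * osc s t \<omega>)) \<partial>M) \<le>
      (\<integral>\<^sup>+\<omega>. ennreal (11 / 10) * indicator A \<omega> +
        (\<Sum>j. ennreal (11 / 100 * (11 / 10) ^ j) * indicator (E j) \<omega>) \<partial>M)"
    by (intro nn_integral_mono pointwise)
  also have "\<dots> = ennreal (11 / 10) * emeasure M A +
      (\<Sum>j. ennreal (11 / 100 * (11 / 10) ^ j) * emeasure M (E j))"
    using AM EM
    by (simp add: nn_integral_add nn_integral_suminf nn_integral_cmult_indicator)
  also have "(\<Sum>j. ennreal (11 / 100 * (11 / 10) ^ j) * emeasure M (E j)) \<le>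
      (\<Sum>j. ennreal (11 / 100 * (11 / 20) ^ j) * emeasure M A)"
  proof (rule suminf_le)
    fix j
    have "ennreal (11 / 100 * (11 / 10) ^ j) * emeasure M (E j) \<le>
        ennreal (11 / 100 * (11 / 10) ^ j) * (ennreal ((1 / 2) ^ j) * emeasure M A)"
      using emeasure_less_osc_le[OF st A c] rho
      by (intro mult_left_mono) (auto simp: E_def c_def)
    also have "\<dots> = ennreal (11 / 100 * (11 / 10) ^ j * (1 / 2) ^ j) * emeasure M A"
      by (subst (2) ennreal_mult) (simp_all add: mult.assoc)
    also have "11 / 100 * (11 / 10) ^ j * (1 / 2) ^ j = (11 / 100 * (11 / 20) ^ j :: real)"
      by (simp add: power_mult_distrib[symmetric] mult.assoc)
    finally show "ennreal (11 / 100 * (11 / 10) ^ j) * emeasure M (E j) \<le>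
        ennreal (11 / 100 * (11 / 20) ^ j) * emeasure M A" .
  qed auto
  also have "(\<Sum>j. ennreal (11 / 100 * (11 / 20) ^ j) * emeasure M A) = ennreal (11 / 45) * emeasure M A"
    by (simp only: ennreal_suminf_multc series)
  also have "ennreal (11 / 10) * emeasure M A + ennreal (11 / 45) * emeasure M A
      = ennreal (11 / 10 + 11 / 45) * emeasure M A"
    by (subst ennreal_plus) (auto simp: distrib_right)
  \<comment> \<open>The sum is \<open>121 / 90\<close>. The rounding to \<open>7 / 5\<close> keeps
    the square, \<open>49 / 25\<close>, below \<open>2\<close>.\<close>
  also have "\<dots> \<le> ennreal (7 / 5) * emeasure M A"
    by (intro mult_right_mono ennreal_leI) auto
  finally show "(\<integral>\<^sup>+\<omega>\<in>A. ennreal (exp (\<beta> * osc s t \<omega>)) \<partial>M) \<le> ennreal (7 / 5) * emeasure M A"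
    by (simp add: add_left_mono)
qed

section \<open>Greedy decomposition into blocks\<close>

text \<open>Induction on the number of steps of length \<open>h\<close> needed to reach \<tau>. The
  points \<pi> list only the ends of blocks, each with factor \<open>2\<close>; the final interval
  up to \<tau> accounts for the \<open>7 / 5\<close>.\<close>

lemma exists_exp_bound_blocks:
  assumes lam: "0 < \<beta>" and h: "0 < h"
    and small: "\<And>u v. 0 \<le> u \<Longrightarrow> u \<le> v \<Longrightarrow> v \<le> \<tau> \<Longrightarrow> v - u \<le> h \<Longrightarrow>
      rho M F V u v \<le> ennreal (1 / (22 * \<beta>))"
    and s: "0 \<le> s" "s \<le> \<tau>" and n: "\<tau> - s \<le> real n * h"
  shows "\<exists>N \<pi>. \<pi> 0 = s \<and> \<pi> N \<le> \<tau> \<and>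
    (\<forall>i<N. \<pi> i < \<pi> (Suc i) \<and> ennreal (1 / (22 * \<beta>)) < rho M F V (\<pi> i) (\<pi> (Suc i))) \<and>
    exp_bound \<beta> s \<tau> (ennreal (2 ^ N * (7 / 5)))"
  using s n
proof (induction n arbitrary: s)
  case 0
  then have "rho M F V s \<tau> \<le> ennreal (1 / (22 * \<beta>))"
    using h by (intro small) auto
  with 0 lam show ?case
    using exp_bound_if_rho_le[of s \<tau> \<beta>] by (intro exI[of _ 0] exI[of _ "\<lambda>_. s"]) auto
next
  case (Suc n)
  show ?case
  proof (cases "rho M F V s \<tau> \<le> ennreal (1 / (22 * \<beta>))")
    case True
    with Suc.prems lam show ?thesis
      using exp_bound_if_rho_le[of s \<tau> \<beta>] by (intro exI[of _ 0] exI[of _ "\<lambda>_. s"]) auto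
  next
    case False
    have "rho M F V s s \<le> ennreal (1 / (22 * \<beta>))"
      using Suc.prems h by (intro small) auto
    \<comment> \<open>The block is \<open>[s, v]\<close>: up to \<open>u\<close> its
      \<open>rho\<close> is still small, and \<open>[u, v]\<close> is short enough for
      \<open>small\<close>. Both pieces therefore admit the bound \<open>7 / 5\<close>.\<close>
    from exists_short_crossing[of s \<tau> h "\<lambda>u. rho M F V s u \<le> ennreal (1 / (22 * \<beta>))", OF Suc.prems(2) h this False]
    obtain u v where uv: "s \<le> u" "u < v" "v \<le> \<tau>" "v - u \<le> h"
      and su: "rho M F V s u \<le> ennreal (1 / (22 * \<beta>))"
      and sv: "ennreal (1 / (22 * \<beta>)) < rho M F V s v"
      by (auto simp: not_le)
    \<comment> \<open>Otherwise \<open>small\<close> would contradict the large \<open>rho\<close>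
      of the block. Hence each block uses up one step of the induction.\<close>
    have "\<not> v - s \<le> h"
      using small[of s v] sv uv Suc.prems by auto
    then have "\<tau> - v \<le> real n * h"
      using Suc.prems(3) by (simp add: algebra_simps)
    then obtain N \<pi> where \<pi>: "\<pi> 0 = v" "\<pi> N \<le> \<tau>"
      "\<And>i. i < N \<Longrightarrow> \<pi> i < \<pi> (Suc i) \<and> ennreal (1 / (22 * \<beta>)) < rho M F V (\<pi> i) (\<pi> (Suc i))"
      "exp_bound \<beta> v \<tau> (ennreal (2 ^ N * (7 / 5)))"
      using Suc.IH[of v] uv Suc.prems by auto
    have "exp_bound \<beta> s u (ennreal (7 / 5))"
      using Suc.prems uv su lam by (intro exp_bound_if_rho_le) auto
    moreover have "exp_bound \<beta> u v (ennreal (7 / 5))"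
      using Suc.prems uv lam by (intro exp_bound_if_rho_le small) auto
    ultimately have "exp_bound \<beta> s v (ennreal (7 / 5) * ennreal (7 / 5))"
      using Suc.prems uv lam by (intro exp_bound_chain[of s u v]) auto
    then have "exp_bound \<beta> s v (ennreal 2)"
      by (rule exp_bound_mono) (simp add: ennreal_mult'[symmetric] del: ennreal_numeral)
    from exp_bound_chain[OF _ _ _ _ lam this \<pi>(4)]
    have "exp_bound \<beta> s \<tau> (ennreal (2 ^ N * (7 / 5)) * ennreal 2)"
      using Suc.prems uv by auto
    also have "ennreal (2 ^ N * (7 / 5)) * ennreal 2 = ennreal (2 ^ Suc N * (7 / 5))"
      by (simp add: ennreal_mult'[symmetric] mult_ac del: ennreal_numeral)
    finally have bound: "exp_bound \<beta> s \<tau> (ennreal (2 ^ Suc N * (7 / 5)))" .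
    show ?thesis
    proof (intro exI conjI allI impI)
      show "exp_bound \<beta> s \<tau> (ennreal (2 ^ Suc N * (7 / 5)))" by fact
      show "case_nat s \<pi> 0 = s" "case_nat s \<pi> (Suc N) \<le> \<tau>" using \<pi> by auto
      fix i assume i: "i < Suc N"
      show "case_nat s \<pi> i < case_nat s \<pi> (Suc i)"
        using i \<pi> uv by (cases i) auto
      show "ennreal (1 / (22 * \<beta>)) < rho M F V (case_nat s \<pi> i) (case_nat s \<pi> (Suc i))"
        using i \<pi> sv by (cases i) auto
    qed
  qed
qed

end

subsection \<open>Counting blocks by the control\<close>

text \<open>The chain is completed to a partition by adding \<open>0\<close> and \<tau> where they
  are missing, as partitions must be strictly increasing. The added terms are nonnegative.\<close>

lemma sum_le_SUP_partitions:
  fixes f :: "real \<Rightarrow> real \<Rightarrow> ennreal"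
  assumes "0 \<le> \<pi> 0" "\<pi> N \<le> \<tau>" "\<And>i. i < N \<Longrightarrow> \<pi> i < \<pi> (Suc i)"
  shows "(\<Sum>i<N. f (\<pi> i) (\<pi> (Suc i))) \<le> (SUP (n, \<pi>)\<in>partitions \<tau>. \<Sum>i<n. f (\<pi> i) (\<pi> (Suc i)))"
    (is "_ \<le> ?W")
proof -
  have from_0: "(\<Sum>i<N. f (\<pi> i) (\<pi> (Suc i))) \<le> ?W"
    if \<pi>: "\<pi> 0 = 0" "\<pi> N \<le> \<tau>" "\<And>i. i < N \<Longrightarrow> \<pi> i < \<pi> (Suc i)" for N and \<pi> :: "nat \<Rightarrow> real"
  proof (cases "\<pi> N = \<tau>")
    case True
    with \<pi> have "(N, \<pi>) \<in> partitions \<tau>" by (simp add: partitions_def)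
    then show ?thesis by (rule SUP_upper2) simp
  next
    case False
    let ?\<pi> = "\<pi>(Suc N := \<tau>)"
    have part: "(Suc N, ?\<pi>) \<in> partitions \<tau>"
      using \<pi> False by (auto simp: partitions_def less_Suc_eq)
    have "(\<Sum>i<N. f (\<pi> i) (\<pi> (Suc i))) = (\<Sum>i<N. f (?\<pi> i) (?\<pi> (Suc i)))"
      by (intro sum.cong) auto
    then have "(\<Sum>i<N. f (\<pi> i) (\<pi> (Suc i))) \<le> (\<Sum>i<Suc N. f (?\<pi> i) (?\<pi> (Suc i)))"
      by simp
    then show ?thesis
      by (intro SUP_upper2[OF part]) (simp only: prod.case)
  qed
  show ?thesis
  proof (cases "\<pi> 0 = 0")
    case True
    then show ?thesis using assms by (intro from_0) auto
  next
    case False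
    let ?\<pi> = "case_nat 0 \<pi>"
    have "(\<Sum>i<N. f (\<pi> i) (\<pi> (Suc i))) \<le> (\<Sum>i<Suc N. f (?\<pi> i) (?\<pi> (Suc i)))"
      by (subst sum.lessThan_Suc_shift) simp
    also have "\<dots> \<le> ?W"
    proof (rule from_0)
      fix i assume "i < Suc N"
      then show "?\<pi> i < ?\<pi> (Suc i)" using assms False by (cases i) auto
    qed (use assms in auto)
    finally show ?thesis .
  qed
qed

lemma enn_powr_lower:
  assumes "0 \<le> c" "ennreal c \<le> x" "0 \<le> p"
  shows "ennreal (c powr p) \<le> enn_powr x p"
  using assms
  by (cases x) (auto simp: enn_powr_def intro!: ennreal_leI powr_mono2)

text \<open>\<open>enn_powr\<close> sends \<infinity> to \<infinity>, so a finite seminorm forces a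
  finite supremum, on which the exponents \<open>1 / p\<close> and \<open>p\<close> cancel.\<close>

lemma vmo_control_eq:
  assumes p: "1 \<le> p" and fin: "vmo_pvar_seminorm M F p \<tau> V < \<infinity>"
  shows "ennreal (vmo_control M F p \<tau> V) =
    (SUP (n, \<pi>)\<in>partitions \<tau>. \<Sum>i<n. enn_powr (rho M F V (\<pi> i) (\<pi> (Suc i))) p)"
    (is "_ = ?W")
proof -
  define W where "W = ?W"
  have eq: "vmo_pvar_seminorm M F p \<tau> V = enn_powr W (1 / p)"
    by (simp only: vmo_pvar_seminorm_def W_def)
  with fin have W: "W \<noteq> \<infinity>" by (auto simp: enn_powr_def)
  then have "vmo_control M F p \<tau> V = (enn2real W powr (1 / p)) powr p"
    unfolding vmo_control_def eq by (simp add: enn_powr_def)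
  also have "\<dots> = enn2real W"
    using p by (simp add: powr_powr)
  finally show ?thesis
    using W unfolding W_def[symmetric] by (simp add: less_top)
qed

theorem theorem3p4:
  fixes M :: "'a measure" and F :: "real \<Rightarrow> 'a measure"
    and \<tau> :: real and V :: "real \<Rightarrow> 'a \<Rightarrow> real"
  assumes "0 < \<tau>"
    and "usual_filtered_prob_space M F"
    and "VMO M F \<tau> V"
  shows "(\<forall>r\<in>{0..\<tau>}. \<forall>c>0. AE \<omega> in M. cond_exp_moment M F \<tau> V c r \<omega> < \<infinity>) \<and>
    (\<forall>p\<ge>1. VMO_pvar M F p \<tau> V \<longrightarrow>
      (\<forall>c>0. \<forall>r\<in>{0..\<tau>}. AE \<omega> in M. cond_exp_moment M F \<tau> V c r \<omega>
         \<le> ennreal (2 powr (1 + (22 * c) powr p * vmo_control M F p \<tau> V))))"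
proof -
  interpret usual_filtered_prob_space M F by fact
  interpret rcll_process M F \<tau> V
    using assms by unfold_locales (auto simp: VMO_def BMO_def)
  \<comment> \<open>Both claims rest on this: a finite \<open>N\<close> gives integrability, and the
    lower bounds on \<open>rho\<close> let the control count the blocks.\<close>
  have main: "\<exists>N \<pi>. \<pi> 0 = r \<and> \<pi> N \<le> \<tau> \<and>
      (\<forall>i<N. \<pi> i < \<pi> (Suc i) \<and> ennreal (1 / (22 * c)) < rho M F V (\<pi> i) (\<pi> (Suc i))) \<and>
      (AE \<omega> in M. cond_exp_moment M F \<tau> V c r \<omega> \<le> ennreal (2 ^ N * (7 / 5)))"
    if r: "r \<in> {0..\<tau>}" and c: "0 < c" for r c
  proof -
    \<comment> \<open>Vanishing \<open>kappa\<close> provides a single length \<open>h\<close> below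
      which \<open>rho\<close> is small on all of \<open>[0, \<tau>]\<close>.\<close>
    have "kappa M F V 0 \<tau> < ennreal (1 / (22 * c))"
      using assms(3) c by (simp add: VMO_def)
    then obtain h where "h \<in> {0<..}"
      and lt: "(SUP (u, v)\<in>{(u, v). 0 \<le> u \<and> u \<le> v \<and> v \<le> \<tau> \<and> v - u \<le> h}. rho M F V u v) < ennreal (1 / (22 * c))"
      unfolding kappa_eq_INF INF_less_iff by blast
    then have h: "0 < h" by simp
    have small: "rho M F V u v \<le> ennreal (1 / (22 * c))"
      if "0 \<le> u" "u \<le> v" "v \<le> \<tau>" "v - u \<le> h" for u v
    proof -
      have "rho M F V u v \<le>
          (SUP (u, v)\<in>{(u, v). 0 \<le> u \<and> u \<le> v \<and> v \<le> \<tau> \<and> v - u \<le> h}. rho M F V u v)"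
        using that by (intro SUP_upper2[of "(u, v)"]) auto
      with lt show ?thesis by order
    qed
    obtain n where "\<tau> - r < real n * h"
      using reals_Archimedean3[OF h] by blast
    then have "\<tau> - r \<le> real n * h" by simp
    with r have "\<exists>N \<pi>. \<pi> 0 = r \<and> \<pi> N \<le> \<tau> \<and>
        (\<forall>i<N. \<pi> i < \<pi> (Suc i) \<and> ennreal (1 / (22 * c)) < rho M F V (\<pi> i) (\<pi> (Suc i))) \<and>
        exp_bound c r \<tau> (ennreal (2 ^ N * (7 / 5)))"
      by (intro exists_exp_bound_blocks[OF c h small]) auto
    then obtain N \<pi> where \<pi>: "\<pi> 0 = r" "\<pi> N \<le> \<tau>"
      "\<forall>i<N. \<pi> i < \<pi> (Suc i) \<and> ennreal (1 / (22 * c)) < rho M F V (\<pi> i) (\<pi> (Suc i))"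
      and "exp_bound c r \<tau> (ennreal (2 ^ N * (7 / 5)))"
      by blast
    then have "AE \<omega> in M. cond_exp_moment M F \<tau> V c r \<omega> \<le> ennreal (2 ^ N * (7 / 5))"
      using exp_bound_imp_AE[of r \<tau> c "ennreal (2 ^ N * (7 / 5))"] r
      by (simp add: cond_exp_moment_def osc_def)
    with \<pi> show ?thesis by blast
  qed
  show ?thesis
  proof (intro conjI ballI allI impI)
    fix r c :: real assume "r \<in> {0..\<tau>}" "0 < c"
    then obtain N where "AE \<omega> in M. cond_exp_moment M F \<tau> V c r \<omega> \<le> ennreal (2 ^ N * (7 / 5))"
      using main by blast
    then show "AE \<omega> in M. cond_exp_moment M F \<tau> V c r \<omega> < \<infinity>"
      by eventually_elim (simp add: le_less_trans)
  next
    fix p c r :: real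
    assume p: "1 \<le> p" and pvar: "VMO_pvar M F p \<tau> V" and c: "0 < c" and r: "r \<in> {0..\<tau>}"
    let ?w = "vmo_control M F p \<tau> V"
    from main[OF r c] obtain N \<pi> where \<pi>: "\<pi> 0 = r" "\<pi> N \<le> \<tau>"
      "\<And>i. i < N \<Longrightarrow> \<pi> i < \<pi> (Suc i)"
      "\<And>i. i < N \<Longrightarrow> ennreal (1 / (22 * c)) < rho M F V (\<pi> i) (\<pi> (Suc i))"
      and bound: "AE \<omega> in M. cond_exp_moment M F \<tau> V c r \<omega> \<le> ennreal (2 ^ N * (7 / 5))"
      by blast
    \<comment> \<open>Every block contributes at least \<open>(1 / (22 * c)) powr p\<close> to a
      partition sum, so \<open>N\<close> is at most \<open>(22 * c) powr p * ?w\<close>.\<close>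
    have "ennreal (real N * (1 / (22 * c)) powr p) = (\<Sum>i<N. ennreal ((1 / (22 * c)) powr p))"
      by (simp add: ennreal_mult ennreal_of_nat_eq_real_of_nat)
    also have "\<dots> \<le> (\<Sum>i<N. enn_powr (rho M F V (\<pi> i) (\<pi> (Suc i))) p)"
      using \<pi>(4) p c by (intro sum_mono enn_powr_lower) (auto intro: less_imp_le)
    also have "\<dots> \<le> (SUP (n, \<pi>)\<in>partitions \<tau>. \<Sum>i<n. enn_powr (rho M F V (\<pi> i) (\<pi> (Suc i))) p)"
      using \<pi> r by (intro sum_le_SUP_partitions) auto
    also have "\<dots> = ennreal ?w"
      using pvar p by (intro vmo_control_eq[symmetric]) (auto simp: VMO_pvar_def)
    finally have "real N * (1 / (22 * c)) powr p \<le> ?w"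
      by (simp add: vmo_control_def)
    then have "real N \<le> (22 * c) powr p * ?w"
      using c by (simp add: powr_divide field_simps)
    then have "2 powr (1 + real N) \<le> 2 powr (1 + (22 * c) powr p * ?w)"
      by (intro powr_mono) auto
    \<comment> \<open>The \<open>1\<close> in the exponent absorbs the factor \<open>7 / 5\<close>
      of the last interval.\<close>
    moreover have "2 ^ N * (7 / 5) \<le> (2 powr (1 + real N) :: real)"
      by (simp add: powr_add powr_realpow)
    ultimately have le: "ennreal (2 ^ N * (7 / 5)) \<le> ennreal (2 powr (1 + (22 * c) powr p * ?w))"
      by (intro ennreal_leI) linarith
    from bound show "AE \<omega> in M. cond_exp_moment M F \<tau> V c r \<omega>
        \<le> ennreal (2 powr (1 + (22 * c) powr p * ?w))"
      by eventually_elim (rule order_trans[OF _ le])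
  qed
qed

end
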